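(* Let $\alpha\ge 0$ and $\beta\ge 0$ be real numbers, and let $f\in\mathcal{A}$ satisfy $f(z)f'(z)/z\neq 0$ for all $z\in\mathbb{D}$. If at least one of the following inequalities holds for all $z\in\mathbb{D}$: (i) $\operatorname{Re}\big(Q_{ST}(\alpha Q_{CV}+\beta Q_{SD})\big)>-\alpha/2$; (ii) $\operatorname{Re}\big(Q_{CV}(\alpha Q_{ST}+\beta Q_{SD})\big)>-\alpha/2$; (iii) $\operatorname{Re}\big(Q_{ST}(\alpha Q_{ST}+\beta Q_{SD})\big)>0$; (iv) $\operatorname{Re}\big(Q_{CV}(\alpha Q_{CV}+\beta Q_{SD})\big)>0$; then $f$ is starlike.
   Context: $\mathbb{D}=\{z\in\mathbb{C}:|z|<1\}$. $\mathcal{A}$ is the class of analytic functions $f:\mathbb{D}\to\mathbb{C}$ with $f(0)=0$ and $f'(0)=1$. For $f\in\mathcal{A}$, as functions of $z\in\mathbb{D}$: $Q_{ST}=zf'(z)/f(z)$ (with the removable singularity at $z=0$ filled in, value $1$), $Q_{CV}=1+zf''(z)/f'(z)$, and $Q_{SD}=z^2\Big(\big(f''(z)/f'(z)\big)'-\tfrac12\big(f''(z)/f'(z)\big)^2\Big)$ ($z^2$ times the Schwarzian derivative of $f$). The condition $f(z)f'(z)/z\neq0$ is understood at $z=0$ via the removable singularity (where the value is $1$). A function $f\in\mathcal{A}$ is starlike if $\operatorname{Re}Q_{ST}>0$ on $\mathbb{D}$; equivalently, $f$ is univalent and $tf(z)\in f(\mathbb{D})$ for all $z\in\mathbb{D}$,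 $t\in[0,1]$. *)

theory Defs
  imports "HOL-Complex_Analysis.Complex_Analysis"
begin

text \<open>
  Only the restriction of \<open>f\<close> to the open unit disk \<open>ball 0 1\<close> matters; the values of the
  total function \<open>f\<close> outside the disk are irrelevant, and \<open>deriv\<close> at a point of the open disk
  depends only on that restriction.
\<close>

definition class_A :: "(complex \<Rightarrow> complex) set" where
  "class_A = {f. f holomorphic_on ball 0 1 \<and> f 0 = 0 \<and> deriv f 0 = 1}"

text \<open>
  For \<open>f \<in> class_A\<close> the quotients \<open>z f'(z) / f(z)\<close> and \<open>f(z) f'(z) / z\<close> have a removable
  singularity at \<open>0\<close>, with limit \<open>1\<close> in both cases; the library's \<open>x / 0 = 0\<close> would give the
  wrong value there, so it is filled in explicitly.
\<close>

definition Q_ST :: "(complex \<Rightarrow> complex) \<Rightarrow> complex \<Rightarrow> complex" where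
  "Q_ST f z = (if z = 0 then 1 else z * deriv f z / f z)"

definition Q_CV :: "(complex \<Rightarrow> complex) \<Rightarrow> complex \<Rightarrow> complex" where
  "Q_CV f z = 1 + z * deriv (deriv f) z / deriv f z"

definition schwarzian :: "(complex \<Rightarrow> complex) \<Rightarrow> complex \<Rightarrow> complex" where
  "schwarzian f z =
     deriv (\<lambda>w. deriv (deriv f) w / deriv f w) z - 1 / 2 * (deriv (deriv f) z / deriv f z)\<^sup>2"

definition Q_SD :: "(complex \<Rightarrow> complex) \<Rightarrow> complex \<Rightarrow> complex" where
  "Q_SD f z = z\<^sup>2 * schwarzian f z"

definition ff'_over_z :: "(complex \<Rightarrow> complex) \<Rightarrow> complex \<Rightarrow> complex" where
  "ff'_over_z f z = (if z = 0 then 1 else f z * deriv f z / z)"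

text \<open>
  Starlikeness of a function, not to be confused with the library's predicate \<open>starlike\<close> on
  sets. If \<open>f z = 0\<close> for some \<open>z \<noteq> 0\<close> in the disk, then \<open>Q_ST f z = 0\<close> by the convention
  \<open>x / 0 = 0\<close>, so such an \<open>f\<close> is not starlike, as it should be.
\<close>

definition starlike_function :: "(complex \<Rightarrow> complex) \<Rightarrow> bool" where
  "starlike_function f \<longleftrightarrow> f \<in> class_A \<and> (\<forall>z\<in>ball 0 1. Re (Q_ST f z) > 0)"

end

theory Submission
  imports Defs
begin

text \<open>
  Write \<open>p = Q_ST f\<close>, \<open>q = Q_CV f\<close> and \<open>S = Q_SD f\<close>. Logarithmic differentiation expresses all
  three through \<open>p\<close> alone: \<open>q = p + z p' / p\<close> and \<open>S = z q' + (1 - q\<^sup>2) / 2\<close>.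

  Suppose \<open>Re p\<close> is not positive throughout the disk. As \<open>p 0 = 1\<close>, there is a point \<open>z\<close> of least
  modulus at which \<open>Re p\<close> fails to be positive; there \<open>Re p\<close> vanishes and is minimal over the closed
  disk of radius \<open>\<bar>z\<bar>\<close>. Moving along the circle, the first-order condition makes \<open>\<sigma> = z p'\<close> real and
  the second-order condition gives \<open>Re (z p' + z\<^sup>2 p'') \<le> 0\<close>. Moving along the radius, the lower
  bound \<open>(1 - t) / (1 + t)\<close> of Harnack for positive real parts gives \<open>\<sigma> \<le> -1/2\<close>. This is
  \<open>first_zero_of_Re\<close>, a weak form of a lemma of Miller and Mocanu.

  At that point \<open>p = i \<rho>\<close>, with \<open>\<rho> \<noteq> 0\<close> since \<open>f'\<close> has no zeros, and therefore \<open>q = i (\<rho> - \<sigma> / \<rho>)\<close> is also purely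
  imaginary, with imaginary part of the same sign as \<open>\<rho>\<close> because \<open>\<sigma> < 0\<close>. The only part of \<open>S\<close> that need
  not be real is \<open>(z p' + z\<^sup>2 p'') / p\<close>, so that multiplying \<open>S\<close> by \<open>p\<close> or by \<open>q\<close> yields a nonpositive real
  part. The remaining products have real parts \<open>Re (p q) = \<sigma> - \<rho>\<^sup>2 \<le> -1/2\<close>, \<open>Re p\<^sup>2 \<le> 0\<close> and
  \<open>Re q\<^sup>2 \<le> 0\<close>, so each of the four inequalities is violated at \<open>z\<close>.
\<close>

section \<open>The first zero of the real part\<close>

lemma second_derivative_nonneg_at_min:
  fixes g h :: "real \<Rightarrow> real"
  assumes g: "\<And>x. (g has_real_derivative h x) (at x)"
    and h: "(h has_real_derivative c) (at a)"
    and min: "\<And>x. g a \<le> g x"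
  shows "h a = 0" and "c \<ge> 0"
proof -
  show h0: "h a = 0"
    using DERIV_local_min[OF g, of 1 a] min by auto
  show "c \<ge> 0"
  proof (rule ccontr)
    assume "\<not> c \<ge> 0"
    then obtain d where d: "d > 0" "\<And>x. 0 < x \<Longrightarrow> x < d \<Longrightarrow> h (a + x) < h a"
      using DERIV_neg_dec_right[OF h] by auto
    obtain \<xi> where \<xi>: "a < \<xi>" "\<xi> < a + d / 2" "g (a + d / 2) - g a = (a + d / 2 - a) * h \<xi>"
      using MVT2[of a "a + d / 2" g h] g d(1) by auto
    have "h \<xi> < 0"
      using d(2)[of "\<xi> - a"] \<xi>(1,2) d(1) h0 by auto
    then have "g (a + d / 2) < g a"
      using \<xi>(3) mult_pos_neg[of "d / 2" "h \<xi>"] d(1) by simp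
    then show False
      using min[of "a + d / 2"] by simp
  qed
qed

text \<open>
  The Cayley transform \<open>(p - 1) / (p + 1)\<close> of \<open>p\<close> satisfies the hypotheses of the Schwarz lemma.
\<close>

lemma Harnack_lower_bound:
  assumes holo: "p holomorphic_on ball 0 1" and p0: "p 0 = 1"
    and pos: "\<And>z. norm z < 1 \<Longrightarrow> Re (p z) > 0" and z: "norm z < 1"
  shows "(1 - norm z) / (1 + norm z) \<le> Re (p z)"
proof -
  define w where "w = (\<lambda>z. (p z - 1) / (p z + 1))"
  have nz: "p z + 1 \<noteq> 0" if "norm z < 1" for z
    using pos[OF that] by (auto simp: complex_eq_iff)
  have "w holomorphic_on ball 0 1"
    unfolding w_def using nz by (intro holomorphic_intros holo) auto
  moreover have "w 0 = 0"
    by (simp add: w_def p0)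
  moreover have "norm (w z) < 1" if "norm z < 1" for z
  proof -
    have "(norm (p z - 1))\<^sup>2 < (norm (p z + 1))\<^sup>2"
      using pos[OF that] unfolding cmod_power2 by (simp add: power2_eq_square algebra_simps)
    then have "norm (p z - 1) < norm (p z + 1)"
      by (rule power2_less_imp_less) simp
    then show ?thesis
      using nz[OF that] by (simp add: w_def norm_divide)
  qed
  ultimately have le: "norm (w z) \<le> norm z"
    using Schwarz_Lemma(1)[of w z] z by blast
  define t u v where "t = norm z" and "u = Re (p z)" and "v = Im (p z)"
  have t: "0 \<le> t" "t < 1"
    using z by (auto simp: t_def)
  have u: "u > 0"
    using pos[OF z] by (simp add: u_def)
  have "norm (p z - 1) \<le> t * norm (p z + 1)"
    using le nz[OF z] by (simp add: w_def t_def norm_divide divide_simps)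
  then have "(norm (p z - 1))\<^sup>2 \<le> (t * norm (p z + 1))\<^sup>2"
    by (intro power_mono) auto
  then have "(u - 1)\<^sup>2 + v\<^sup>2 \<le> t\<^sup>2 * ((u + 1)\<^sup>2 + v\<^sup>2)"
    by (simp add: power_mult_distrib cmod_power2 u_def v_def)
  moreover have "t\<^sup>2 * v\<^sup>2 \<le> 1 * v\<^sup>2"
    using t by (intro mult_right_mono) (auto simp: power_le_one)
  ultimately have "(u - 1)\<^sup>2 \<le> (t * (u + 1))\<^sup>2"
    unfolding power_mult_distrib[of t] by (simp add: distrib_left)
  then have "\<bar>u - 1\<bar> \<le> t * (u + 1)"
    unfolding abs_le_square_iff[symmetric] using t u by (simp add: abs_of_nonneg)
  then have "1 - t \<le> u * (1 + t)"
    by (simp add: algebra_simps)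
  then have "(1 - t) / (1 + t) \<le> u"
    using t by (simp add: pos_divide_le_eq)
  then show ?thesis
    unfolding t_def u_def .
qed

lemma has_real_derivative_Re_along_curve:
  fixes \<gamma> :: "real \<Rightarrow> complex"
  assumes "(\<gamma> has_vector_derivative d) (at t)" "(p has_field_derivative D) (at (\<gamma> t))"
  shows "((\<lambda>t. Re (p (\<gamma> t))) has_real_derivative Re (d * D)) (at t)"
proof -
  have "(p \<circ> \<gamma> has_vector_derivative d * D) (at t)"
    by (rule field_vector_diff_chain_at[OF assms])
  from bounded_linear.has_vector_derivative[OF bounded_linear_Re this] show ?thesis
    by (simp add: o_def has_real_derivative_iff_has_vector_derivative)
qed

text \<open>
  At the chosen point \<open>z\<close> the angular derivatives of \<open>Re (p (z e\<^sup>i\<^sup>\<theta>))\<close> at \<open>\<theta> = 0\<close> are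
  \<open>- Im (z p')\<close> and \<open>- Re (z p' + z\<^sup>2 p'')\<close>, and the radial derivative of \<open>Re (p (t z))\<close> at \<open>t = 1\<close>
  is \<open>Re (z p')\<close>.
\<close>

lemma first_zero_of_Re:
  assumes holo: "p holomorphic_on ball 0 1" and p0: "p 0 = 1"
    and bad: "norm z1 < 1" "Re (p z1) \<le> 0"
  obtains z where "norm z < 1" "z \<noteq> 0" "Re (p z) = 0"
    "Im (z * deriv p z) = 0" "Re (z * deriv p z) \<le> - 1 / 2"
    "Re (z * deriv p z + z\<^sup>2 * deriv (deriv p) z) \<le> 0"
proof -
  have cont: "continuous_on (cball 0 (norm z1)) (\<lambda>z. Re (p z))"
    using bad(1) by (intro continuous_intros holomorphic_on_imp_continuous_on
        holomorphic_on_subset[OF holo]) auto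
  define K where "K = {z \<in> cball 0 (norm z1). Re (p z) \<in> {..0}}"
  have "closed K"
    using continuous_closed_preimage[OF cont, of "{..0}"] by (simp add: K_def vimage_def Int_def)
  moreover have "bounded K"
    by (rule bounded_subset[OF bounded_cball[of 0 "norm z1"]]) (auto simp: K_def)
  ultimately have "compact K"
    by (simp add: compact_eq_bounded_closed)
  moreover have "K \<noteq> {}"
    using bad by (auto simp: K_def)
  ultimately obtain z where z: "z \<in> K" "\<And>y. y \<in> K \<Longrightarrow> norm z \<le> norm y"
    using continuous_attains_inf[of K norm] continuous_on_norm_id by blast
  have nz1: "norm z < 1" and rez: "Re (p z) \<le> 0"
    using z(1) bad(1) by (auto simp: K_def)
  have z0: "z \<noteq> 0"
    using rez p0 by auto
  have pos: "Re (p y) > 0" if "norm y < norm z" for y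
    using z(2)[of y] that z(1) by (force simp: K_def)
  have dp: "(p has_field_derivative deriv p y) (at y)" if "norm y < 1" for y
    using holomorphic_derivI[OF holo, of y] that by simp
  have ddp: "(deriv p has_field_derivative deriv (deriv p) y) (at y)" if "norm y < 1" for y
    using holomorphic_derivI[OF holomorphic_deriv[OF holo], of y] that by simp
  \<comment> \<open>Along a radius, \<open>Re p\<close> is a limit of positive values.\<close>
  have nonneg: "Re (p y) \<ge> 0" if y: "norm y = norm z" for y
  proof (rule tendsto_lowerbound)
    have "((\<lambda>t::real. Re (p (of_real t * y))) \<longlongrightarrow> Re (p (of_real 1 * y))) (at_left 1)"
      by (rule tendsto_Re, rule isCont_tendsto_compose[of _ p])
        (use dp[of y] y nz1 in \<open>auto intro!: tendsto_eq_intros DERIV_isCont\<close>)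
    then show "((\<lambda>t::real. Re (p (of_real t * y))) \<longlongrightarrow> Re (p y)) (at_left 1)"
      by simp
    show "\<forall>\<^sub>F t in at_left (1::real). 0 \<le> Re (p (of_real t * y))"
    proof -
      have "0 \<le> Re (p (of_real t * y))" if "0 < t" "t < 1" for t :: real
        using pos[of "of_real t * y"] that y z0 by (simp add: norm_mult)
      then show ?thesis
        unfolding eventually_at_left_field by (intro exI[of _ 0]) auto
    qed
  qed auto
  have re0: "Re (p z) = 0"
    using nonneg[of z] rez by simp

  define g where "g = (\<lambda>\<theta>. Re (p (z * cis \<theta>)))"
  define h where "h = (\<lambda>\<theta>. - Im (z * cis \<theta> * deriv p (z * cis \<theta>)))"
  have dcis: "((\<lambda>\<theta>. z * cis \<theta>) has_vector_derivative \<i> * (z * cis \<theta>)) (at \<theta>)" for \<theta>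
  proof -
    have "((\<lambda>w. z * exp (\<i> * w)) has_field_derivative \<i> * (z * exp (\<i> * of_real \<theta>))) (at (of_real \<theta>))"
      by (auto intro!: derivative_eq_intros)
    from has_vector_derivative_real_field[OF this] show ?thesis
      by (simp add: cis_conv_exp)
  qed
  have norm_cis_z: "norm (z * cis \<theta>) < 1" for \<theta>
    using nz1 by (simp add: norm_mult)
  have g: "(g has_real_derivative h \<theta>) (at \<theta>)" for \<theta>
    using has_real_derivative_Re_along_curve[OF dcis dp[OF norm_cis_z]]
    by (simp add: g_def h_def algebra_simps)
  have h: "(h has_real_derivative - Re (z * deriv p z + z\<^sup>2 * deriv (deriv p) z)) (at 0)"
  proof -
    have "((\<lambda>w. \<i> * (w * deriv p w)) has_field_derivative
        \<i> * (deriv p (z * cis 0) + z * cis 0 * deriv (deriv p) (z * cis 0))) (at (z * cis 0))"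
      using nz1 by (auto intro!: derivative_eq_intros ddp)
    from has_real_derivative_Re_along_curve[OF dcis this] show ?thesis
      by (simp add: h_def algebra_simps power2_eq_square)
  qed
  have min: "g 0 \<le> g \<theta>" for \<theta>
    using nonneg[of "z * cis \<theta>"] re0 by (simp add: g_def norm_mult)
  have angular: "Im (z * deriv p z) = 0" "Re (z * deriv p z + z\<^sup>2 * deriv (deriv p) z) \<le> 0"
    using second_derivative_nonneg_at_min[OF g h min] by (auto simp: h_def)

  have "Re (z * deriv p z) \<le> - 1 / 2"
  proof (rule ccontr)
    assume large: "\<not> ?thesis"
    \<comment> \<open>The bound \<open>(1 - t) / (1 + t)\<close> touches \<open>Re (p (t z))\<close> at \<open>t = 1\<close> with slope \<open>-1/2\<close>.\<close>
    define k where "k = (\<lambda>t::real. Re (p (of_real t * z)) - (1 - t) / (1 + t))"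
    have dk: "(k has_real_derivative Re (z * deriv p z) + 1 / 2) (at 1)"
    proof -
      have "((\<lambda>t. of_real t * z) has_vector_derivative z) (at 1)"
        by (auto intro!: derivative_eq_intros)
      moreover have "(p has_field_derivative deriv p z) (at (of_real 1 * z))"
        using dp[OF nz1] by simp
      ultimately have "((\<lambda>t. Re (p (of_real t * z))) has_real_derivative Re (z * deriv p z)) (at 1)"
        by (rule has_real_derivative_Re_along_curve)
      moreover have "((\<lambda>t::real. (1 - t) / (1 + t)) has_real_derivative - 1 / 2) (at 1)"
        by (auto intro!: derivative_eq_intros)
      ultimately have "(k has_real_derivative Re (z * deriv p z) - - 1 / 2) (at 1)"
        unfolding k_def by (rule DERIV_diff)
      then show ?thesis
        by simp
    qed
    have "Re (z * deriv p z) + 1 / 2 > 0"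
      using large by linarith
    from DERIV_pos_inc_left[OF dk this] obtain d where d: "d > 0" "\<And>x. 0 < x \<Longrightarrow> x < d \<Longrightarrow> k (1 - x) < k 1"
      by blast
    define x where "x = min (d / 2) (1 / 2)"
    have x: "0 < x" "x < d" "x < 1"
      using d(1) by (auto simp: x_def)
    have norm_x: "norm (of_real (1 - x) :: complex) = 1 - x"
      unfolding norm_of_real using x by simp
    have "(1 - norm (of_real (1 - x) :: complex)) / (1 + norm (of_real (1 - x) :: complex))
        \<le> Re (p (of_real (1 - x) * z))"
    proof (rule Harnack_lower_bound[of "\<lambda>\<zeta>. p (\<zeta> * z)"])
      have small: "norm (\<zeta> * z) < norm z" if "norm \<zeta> < 1" for \<zeta>
        using that z0 by (simp add: norm_mult)
      show "(\<lambda>\<zeta>. p (\<zeta> * z)) holomorphic_on ball 0 1"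
      proof (rule holomorphic_on_compose_gen[OF _ holo, unfolded o_def])
        show "(\<lambda>\<zeta>. \<zeta> * z) holomorphic_on ball 0 1"
          by (intro holomorphic_intros)
        show "(\<lambda>\<zeta>. \<zeta> * z) ` ball 0 1 \<subseteq> ball 0 1"
          using less_trans[OF small nz1] by auto
      qed
      show "Re (p (\<zeta> * z)) > 0" if "norm \<zeta> < 1" for \<zeta>
        using pos small[OF that] by blast
      show "p (0 * z) = 1"
        using p0 by simp
      show "norm (of_real (1 - x) :: complex) < 1"
        unfolding norm_x using x by simp
    qed
    then have "k (1 - x) \<ge> 0"
      unfolding k_def norm_x by simp
    moreover have "k 1 = 0"
      by (simp add: k_def re0)
    ultimately show False
      using d(2)[OF x(1,2)] by simp
  qed
  with nz1 z0 re0 angular(1) show thesis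
    using angular(2) by (rule that)
qed

section \<open>The three expressions in terms of one function\<close>

lemma Q_ST_holomorphic:
  assumes f: "f \<in> class_A" and nz: "\<And>z. norm z < 1 \<Longrightarrow> z \<noteq> 0 \<Longrightarrow> f z \<noteq> 0"
  shows "Q_ST f holomorphic_on ball 0 1"
proof -
  have holo: "f holomorphic_on ball 0 1" and f0: "f 0 = 0" and f1: "deriv f 0 = 1"
    using f by (auto simp: class_A_def)
  define g where "g = (\<lambda>z. if z = 0 then deriv f 0 else (f z - f 0) / (z - 0))"
  have "g holomorphic_on ball 0 1"
    unfolding g_def by (rule pole_lemma[OF holo]) simp
  moreover have "g z \<noteq> 0" if "z \<in> ball 0 1" for z
    using nz that f0 f1 by (auto simp: g_def)
  ultimately have "(\<lambda>z. deriv f z / g z) holomorphic_on ball 0 1"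
    by (intro holomorphic_intros holomorphic_deriv[OF holo]) auto
  moreover have "Q_ST f = (\<lambda>z. deriv f z / g z)"
    by (auto simp: Q_ST_def g_def f0 f1)
  ultimately show ?thesis
    by simp
qed

lemma Q_CV_eq_Q_ST:
  assumes holo: "f holomorphic_on S" "open S" "0 \<notin> S" and z: "z \<in> S"
    and nz: "f z \<noteq> 0" "deriv f z \<noteq> 0"
  shows "Q_CV f z = Q_ST f z + z * deriv (Q_ST f) z / Q_ST f z"
proof -
  have z0: "z \<noteq> 0"
    using assms by auto
  have df: "(f has_field_derivative deriv f z) (at z)"
    using holomorphic_derivI[OF holo(1,2) z] .
  have ddf: "(deriv f has_field_derivative deriv (deriv f) z) (at z)"
    using holomorphic_derivI[OF holomorphic_deriv[OF holo(1,2)] holo(2) z] .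
  have "((\<lambda>z. z * deriv f z / f z) has_field_derivative
      ((deriv f z + z * deriv (deriv f) z) * f z - z * deriv f z * deriv f z) / (f z * f z)) (at z)"
    using nz by (auto intro!: derivative_eq_intros df ddf simp: algebra_simps)
  then have "(Q_ST f has_field_derivative
      ((deriv f z + z * deriv (deriv f) z) * f z - z * deriv f z * deriv f z) / (f z * f z)) (at z)"
    by (rule has_field_derivative_transform_within_open[OF _ holo(2) z])
      (use holo(3) in \<open>auto simp: Q_ST_def\<close>)
  then have "deriv (Q_ST f) z
      = ((deriv f z + z * deriv (deriv f) z) * f z - z * deriv f z * deriv f z) / (f z * f z)"
    by (rule DERIV_imp_deriv)
  then show ?thesis
    using z0 nz by (simp add: Q_ST_def Q_CV_def field_simps)
qed

lemma Q_SD_eq_Q_CV: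
  assumes holo: "f holomorphic_on S" "open S" and z: "z \<in> S" and nz: "deriv f z \<noteq> 0"
  shows "Q_SD f z = z * deriv (Q_CV f) z + (1 - (Q_CV f z)\<^sup>2) / 2"
proof -
  define N where "N = (\<lambda>w. deriv (deriv f) w / deriv f w)"
  have hol1: "deriv f holomorphic_on S"
    using holomorphic_deriv[OF holo] .
  have "N field_differentiable (at z)"
    unfolding N_def using holomorphic_derivI[OF hol1 holo(2) z]
      holomorphic_derivI[OF holomorphic_deriv[OF hol1 holo(2)] holo(2) z] nz
    by (intro field_differentiable_divide) (auto simp: field_differentiable_def)
  then have N: "(N has_field_derivative deriv N z) (at z)"
    by (simp add: field_differentiable_derivI)
  have Q: "Q_CV f = (\<lambda>w. 1 + w * N w)"
    by (auto simp: Q_CV_def N_def)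
  have "deriv (Q_CV f) z = N z + z * deriv N z"
    unfolding Q by (rule DERIV_imp_deriv) (auto intro!: derivative_eq_intros N)
  moreover have "Q_SD f z = z\<^sup>2 * (deriv N z - 1 / 2 * (N z)\<^sup>2)"
    by (simp add: Q_SD_def schwarzian_def N_def)
  ultimately show ?thesis
    by (simp add: Q power2_eq_square field_simps)
qed

text \<open>
  The term \<open>(z p' + z\<^sup>2 p'') / p\<close> is kept together because its numerator is the quantity
  controlled by the second-order condition of \<open>first_zero_of_Re\<close>.
\<close>

lemma Q_SD_eq_Q_ST:
  assumes holo: "f holomorphic_on S" "open S" "0 \<notin> S" and z: "z \<in> S"
    and nz: "\<And>z. z \<in> S \<Longrightarrow> f z \<noteq> 0" "\<And>z. z \<in> S \<Longrightarrow> deriv f z \<noteq> 0"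
  defines "p \<equiv> Q_ST f"
  shows "Q_SD f z = z * deriv p z + (z * deriv p z + z\<^sup>2 * deriv (deriv p) z) / p z
    - (z * deriv p z / p z)\<^sup>2 + (1 - (Q_CV f z)\<^sup>2) / 2"
proof -
  have "(\<lambda>z. z * deriv f z / f z) holomorphic_on S"
    using nz by (intro holomorphic_intros holomorphic_deriv holo) auto
  then have hp: "p holomorphic_on S"
    by (rule holomorphic_transform) (use holo(3) in \<open>auto simp: p_def Q_ST_def\<close>)
  have pz: "p z \<noteq> 0"
    using nz[OF z] z holo(3) by (auto simp: p_def Q_ST_def)
  have dp: "(p has_field_derivative deriv p z) (at z)"
    using holomorphic_derivI[OF hp holo(2) z] .
  have ddp: "(deriv p has_field_derivative deriv (deriv p) z) (at z)"
    using holomorphic_derivI[OF holomorphic_deriv[OF hp holo(2)] holo(2) z] .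
  define D where "D = deriv p z + ((deriv p z + z * deriv (deriv p) z) * p z
      - z * deriv p z * deriv p z) / (p z * p z)"
  have "((\<lambda>z. p z + z * deriv p z / p z) has_field_derivative D) (at z)"
    unfolding D_def using pz by (auto intro!: derivative_eq_intros dp ddp simp: algebra_simps)
  then have "(Q_CV f has_field_derivative D) (at z)"
    by (rule has_field_derivative_transform_within_open[OF _ holo(2) z])
      (use Q_CV_eq_Q_ST[OF holo] nz in \<open>auto simp: p_def\<close>)
  then have "deriv (Q_CV f) z = D"
    by (rule DERIV_imp_deriv)
  moreover have "z * D = z * deriv p z + (z * deriv p z + z\<^sup>2 * deriv (deriv p) z) / p z
    - (z * deriv p z / p z)\<^sup>2"
    unfolding D_def using pz by (simp add: field_simps power2_eq_square)
  ultimately show ?thesis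
    using Q_SD_eq_Q_CV[OF holo(1,2) z] nz(2)[OF z] by simp
qed

section \<open>Violation of the inequalities\<close>

text \<open>
  The common shape of the four expressions at the first zero of \<open>Re p\<close>: the factors \<open>i a\<close> and \<open>i b\<close>
  stand for \<open>p\<close> or \<open>q\<close>, and the Schwarzian term is a real number \<open>A\<close> plus \<open>m / p\<close> with \<open>p = i \<rho>\<close>.
\<close>

lemma Re_imaginary_combination_le:
  fixes \<alpha> \<beta> \<rho> a b A :: real and m :: complex
  assumes "\<beta> \<ge> 0" "a / \<rho> \<ge> 0" "Re m \<le> 0"
  shows "Re (\<i> * of_real a * (of_real \<alpha> * (\<i> * of_real b)
      + of_real \<beta> * (of_real A + m / (\<i> * of_real \<rho>)))) \<le> - \<alpha> * (a * b)"
proof -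
  have "\<i> * of_real a * (m / (\<i> * of_real \<rho>)) = of_real (a / \<rho>) * m"
    by simp
  then have "\<i> * of_real a * (of_real \<alpha> * (\<i> * of_real b)
      + of_real \<beta> * (of_real A + m / (\<i> * of_real \<rho>)))
    = of_real (- \<alpha> * (a * b)) + \<i> * of_real (\<beta> * a * A) + of_real (\<beta> * (a / \<rho>)) * m"
    by (simp add: algebra_simps)
  also have "Re \<dots> = - \<alpha> * (a * b) + \<beta> * (a / \<rho>) * Re m"
    by simp
  also have "\<dots> \<le> - \<alpha> * (a * b)"
    using mult_nonneg_nonpos[OF mult_nonneg_nonneg[OF assms(1,2)] assms(3)] by linarith
  finally show ?thesis .
qed

theorem theorem2p1:
  fixes \<alpha> \<beta> :: real and f :: "complex \<Rightarrow> complex"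
  assumes "\<alpha> \<ge> 0" and "\<beta> \<ge> 0"
    and "f \<in> class_A"
    and "\<forall>z\<in>ball 0 1. ff'_over_z f z \<noteq> 0"
    and "(\<forall>z\<in>ball 0 1. Re (Q_ST f z * (of_real \<alpha> * Q_CV f z + of_real \<beta> * Q_SD f z)) > - \<alpha> / 2)
       \<or> (\<forall>z\<in>ball 0 1. Re (Q_CV f z * (of_real \<alpha> * Q_ST f z + of_real \<beta> * Q_SD f z)) > - \<alpha> / 2)
       \<or> (\<forall>z\<in>ball 0 1. Re (Q_ST f z * (of_real \<alpha> * Q_ST f z + of_real \<beta> * Q_SD f z)) > 0)
       \<or> (\<forall>z\<in>ball 0 1. Re (Q_CV f z * (of_real \<alpha> * Q_CV f z + of_real \<beta> * Q_SD f z)) > 0)"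
  shows "starlike_function f"
proof (rule ccontr)
  assume "\<not> starlike_function f"
  then obtain z1 where z1: "norm z1 < 1" "Re (Q_ST f z1) \<le> 0"
    using assms(3) by (auto simp: starlike_function_def not_less)
  have nz: "f z \<noteq> 0 \<and> deriv f z \<noteq> 0" if "norm z < 1" "z \<noteq> 0" for z
    using bspec[OF assms(4), of z] that by (auto simp: ff'_over_z_def)
  have "Q_ST f holomorphic_on ball 0 1" "Q_ST f 0 = 1"
    using Q_ST_holomorphic[OF assms(3)] nz by (auto simp: Q_ST_def)
  from first_zero_of_Re[OF this z1] obtain z where z: "norm z < 1" "z \<noteq> 0"
    and re: "Re (Q_ST f z) = 0"
    and im: "Im (z * deriv (Q_ST f) z) = 0"
    and sigma_le: "Re (z * deriv (Q_ST f) z) \<le> - 1 / 2"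
    and m_le: "Re (z * deriv (Q_ST f) z + z\<^sup>2 * deriv (deriv (Q_ST f)) z) \<le> 0" (is "Re ?m \<le> 0")
    by blast

  have S: "f holomorphic_on ball 0 1 - {0}" "open (ball 0 1 - {0 :: complex})"
    "0 \<notin> ball 0 1 - {0 :: complex}" "z \<in> ball 0 1 - {0}"
    using assms(3) z by (auto simp: class_A_def intro: holomorphic_on_subset)
  define \<rho> \<sigma> where "\<rho> = Im (Q_ST f z)" and "\<sigma> = Re (z * deriv (Q_ST f) z)"
  define \<kappa> where "\<kappa> = \<rho> - \<sigma> / \<rho>"
  define A where "A = \<sigma> + (\<sigma> / \<rho>)\<^sup>2 + (1 + \<kappa>\<^sup>2) / 2"
  have ST: "Q_ST f z = \<i> * of_real \<rho>"
    using re by (simp add: complex_eq_iff \<rho>_def)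
  have "Q_ST f z \<noteq> 0"
    using nz[OF z] z by (simp add: Q_ST_def)
  then have \<rho>: "\<rho> \<noteq> 0"
    using ST by auto
  have s: "z * deriv (Q_ST f) z = of_real \<sigma>"
    using im by (simp add: complex_eq_iff \<sigma>_def)
  have CV: "Q_CV f z = \<i> * of_real \<kappa>"
    using Q_CV_eq_Q_ST[OF S] nz[OF z] \<rho> unfolding s ST \<kappa>_def
    by (simp add: complex_eq_iff Re_divide Im_divide power2_eq_square)
  have "(of_real \<sigma> / (\<i> * of_real \<rho>))\<^sup>2 = - of_real ((\<sigma> / \<rho>)\<^sup>2)"
    by (simp add: power_divide power_mult_distrib)
  then have SD: "Q_SD f z = of_real A + ?m / (\<i> * of_real \<rho>)"
    using Q_SD_eq_Q_ST[OF S] nz unfolding CV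
    by (simp add: s ST A_def power_mult_distrib)

  have \<sigma>: "\<sigma> \<le> - 1 / 2"
    using sigma_le by (simp add: \<sigma>_def)
  have "\<rho>\<^sup>2 > 0"
    using \<rho> by simp
  then have same_sign: "\<rho> / \<rho> \<ge> 0" "\<kappa> / \<rho> \<ge> 0"
    using \<rho> \<sigma> divide_nonpos_pos[of \<sigma> "\<rho>\<^sup>2"] by (auto simp: \<kappa>_def diff_divide_distrib power2_eq_square)
  have "\<rho> * \<kappa> = \<rho>\<^sup>2 - \<sigma>"
    using \<rho> by (simp add: \<kappa>_def power2_eq_square algebra_simps)
  then have "1 / 2 \<le> \<rho> * \<kappa>"
    using \<sigma> \<open>\<rho>\<^sup>2 > 0\<close> by linarith
  then have mixed: "- \<alpha> * (\<rho> * \<kappa>) \<le> - \<alpha> / 2" "- \<alpha> * (\<kappa> * \<rho>) \<le> - \<alpha> / 2"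
    using mult_left_mono[of "1 / 2" "\<rho> * \<kappa>" \<alpha>] assms(1) by (auto simp: mult.commute)
  have pure: "- \<alpha> * (\<rho> * \<rho>) \<le> 0" "- \<alpha> * (\<kappa> * \<kappa>) \<le> 0"
    using assms(1) by auto
  note bound = Re_imaginary_combination_le[OF assms(2) _ m_le, where \<alpha> = \<alpha> and A = A and \<rho> = \<rho>]
  have bounds:
    "Re (Q_ST f z * (of_real \<alpha> * Q_CV f z + of_real \<beta> * Q_SD f z)) \<le> - \<alpha> / 2"
    "Re (Q_CV f z * (of_real \<alpha> * Q_ST f z + of_real \<beta> * Q_SD f z)) \<le> - \<alpha> / 2"
    "Re (Q_ST f z * (of_real \<alpha> * Q_ST f z + of_real \<beta> * Q_SD f z)) \<le> 0"
    "Re (Q_CV f z * (of_real \<alpha> * Q_CV f z + of_real \<beta> * Q_SD f z)) \<le> 0"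
    unfolding ST CV SD
    using order_trans[OF bound[OF same_sign(1)] mixed(1)]
      order_trans[OF bound[OF same_sign(2)] mixed(2)]
      order_trans[OF bound[OF same_sign(1)] pure(1)]
      order_trans[OF bound[OF same_sign(2)] pure(2)] by blast+
  show False
    using assms(5) z(1) bounds[THEN leD] by auto
qed

end
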